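(* For $n\ge 1$, the multiring $M(n)$ is hyperbolic if and only if $\gcd(n,30)=1$. Equivalently, $M(n)$ is hyperbolic if and only if $2\nmid n$, $3\nmid n$, and $5\nmid n$.
   Context: For a positive integer $n$, $\mathbb Z_n=\mathbb Z/n\mathbb Z$, $\mathbb Z_n^\times$ is its group of units, and $S_n=\{u^2:u\in\mathbb Z_n^\times\}$. $M(n)$ denotes the Marshall quotient of $\mathbb Z_n$ by $S_n$: the underlying set is the quotient of $\mathbb Z_n$ by the equivalence relation $a\sim b\iff as=bt$ for some $s,t\in S_n$; the class of $a$ is written $[a]$. The operations are $[a][b]=[ab]$, $-[a]=[-a]$, and the multivalued addition $[a]+[b]=\{[c]: cr=as+bt\text{ for some }r,s,t\in S_n\}$, with zero $[0]$ and unit $[1]$; with these $M(n)$ is a commutative multiring. A multiring $R$ is hyperbolic if $1-1=R$, where $1-1$ denotes the multivalued sum $1+(-1)$. For $M(n)$ this means $[1]+[-1]=M(n)$. *)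

theory Defs
  imports "HOL-Algebra.IntRing"
begin

record 'a multiring = "'a monoid" +
  mzero :: 'a
  mneg :: "'a \<Rightarrow> 'a"
  madd :: "'a \<Rightarrow> 'a \<Rightarrow> 'a set"

definition hyperbolic :: "('a, 'm) multiring_scheme \<Rightarrow> bool" where
  "hyperbolic M \<longleftrightarrow> madd M (one M) (mneg M (one M)) = carrier M"

definition marshall_rel :: "('a, 'm) ring_scheme \<Rightarrow> 'a set \<Rightarrow> ('a \<times> 'a) set" where
  "marshall_rel R S =
     {(a, b). a \<in> carrier R \<and> b \<in> carrier R \<and>
        (\<exists>s\<in>S. \<exists>t\<in>S. a \<otimes>\<^bsub>R\<^esub> s = b \<otimes>\<^bsub>R\<^esub> t)}"

abbreviation marshall_class :: "('a, 'm) ring_scheme \<Rightarrow> 'a set \<Rightarrow> 'a \<Rightarrow> 'a set" where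
  "marshall_class R S a \<equiv> marshall_rel R S `` {a}"

text \<open>Product and negative are formed as unions over all representatives, which makes them
  choice-free; the lemmas below show that they are the classes of the product and the negative.\<close>

definition marshall_quotient :: "('a, 'm) ring_scheme \<Rightarrow> 'a set \<Rightarrow> 'a set multiring" where
  "marshall_quotient R S =
     \<lparr> carrier = carrier R // marshall_rel R S,
       mult = (\<lambda>X Y. \<Union>a\<in>X. \<Union>b\<in>Y. marshall_class R S (a \<otimes>\<^bsub>R\<^esub> b)),
       one = marshall_class R S \<one>\<^bsub>R\<^esub>,
       mzero = marshall_class R S \<zero>\<^bsub>R\<^esub>,
       mneg = (\<lambda>X. \<Union>a\<in>X. marshall_class R S (\<ominus>\<^bsub>R\<^esub> a)),
       madd = (\<lambda>X Y. {marshall_class R S c | a b c.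
          a \<in> carrier R \<and> b \<in> carrier R \<and> c \<in> carrier R \<and>
          X = marshall_class R S a \<and> Y = marshall_class R S b \<and>
          (\<exists>r\<in>S. \<exists>s\<in>S. \<exists>t\<in>S. c \<otimes>\<^bsub>R\<^esub> r = a \<otimes>\<^bsub>R\<^esub> s \<oplus>\<^bsub>R\<^esub> b \<otimes>\<^bsub>R\<^esub> t)}) \<rparr>"

definition unit_squares :: "('a, 'm) ring_scheme \<Rightarrow> 'a set" where
  "unit_squares R = {u \<otimes>\<^bsub>R\<^esub> u | u. u \<in> Units R}"

definition M :: "nat \<Rightarrow> int set set multiring" where
  "M n = marshall_quotient (ZFact (int n)) (unit_squares (ZFact (int n)))"

text \<open>Consistency checks: for a submonoid of the multiplicative monoid (in particular for the
  squares of units) the relation is an equivalence and the operations on classes are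
  given by the expected formulas.\<close>

locale marshall = cring R for R (structure) +
  fixes S
  assumes S_sub: "S \<subseteq> carrier R"
    and S_one: "\<one> \<in> S"
    and S_mult: "\<lbrakk>s \<in> S; t \<in> S\<rbrakk> \<Longrightarrow> s \<otimes> t \<in> S"
begin

abbreviation cl :: "'a \<Rightarrow> 'a set" where "cl a \<equiv> marshall_class R S a"

lemma S_carrier [simp]: "s \<in> S \<Longrightarrow> s \<in> carrier R"
  using S_sub by blast

lemma equiv_rel: "equiv (carrier R) (marshall_rel R S)"
proof (rule equivI)
  show "marshall_rel R S \<subseteq> carrier R \<times> carrier R"
    by (auto simp: marshall_rel_def)
  show "refl_on (carrier R) (marshall_rel R S)"
    unfolding refl_on_def marshall_rel_def using S_one by auto
  show "sym (marshall_rel R S)"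
    unfolding sym_def marshall_rel_def by (auto; metis)
  show "trans (marshall_rel R S)"
  proof (rule transI)
    fix a b c assume ab: "(a, b) \<in> marshall_rel R S" and bc: "(b, c) \<in> marshall_rel R S"
    then obtain s t s' t' where st: "s \<in> S" "t \<in> S" "a \<otimes> s = b \<otimes> t"
      and st': "s' \<in> S" "t' \<in> S" "b \<otimes> s' = c \<otimes> t'"
      and carr: "a \<in> carrier R" "b \<in> carrier R" "c \<in> carrier R"
      by (auto simp: marshall_rel_def)
    have "a \<otimes> (s \<otimes> s') = (a \<otimes> s) \<otimes> s'"
      using st(1) st'(1) carr by (simp add: m_assoc)
    also have "\<dots> = (b \<otimes> s') \<otimes> t"
      unfolding st(3) using st(1,2) st'(1) carr by (simp add: m_ac)
    also have "\<dots> = c \<otimes> (t' \<otimes> t)"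
      unfolding st'(3) using st(2) st'(2) carr by (simp add: m_assoc)
    finally show "(a, c) \<in> marshall_rel R S"
      using S_mult[OF st(1) st'(1)] S_mult[OF st'(2) st(2)] carr
      by (auto simp: marshall_rel_def)
  qed
qed

lemma cl_eq_iff:
  assumes "a \<in> carrier R" "b \<in> carrier R"
  shows "cl a = cl b \<longleftrightarrow> (\<exists>s\<in>S. \<exists>t\<in>S. a \<otimes> s = b \<otimes> t)"
  using assms eq_equiv_class_iff[OF equiv_rel assms] by (simp add: marshall_rel_def)

lemma mult_cl:
  assumes "a \<in> carrier R" "b \<in> carrier R"
  shows "mult (marshall_quotient R S) (cl a) (cl b) = cl (a \<otimes> b)"
proof -
  have "congruent2 (marshall_rel R S) (marshall_rel R S) (\<lambda>a b. cl (a \<otimes> b))"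
  proof (rule congruent2I[OF equiv_rel equiv_rel])
    fix x y z assume yz: "(y, z) \<in> marshall_rel R S" and x: "x \<in> carrier R"
    then obtain s t where st: "s \<in> S" "t \<in> S" "y \<otimes> s = z \<otimes> t"
      and c: "y \<in> carrier R" "z \<in> carrier R"
      by (auto simp: marshall_rel_def)
    have eq: "(x \<otimes> y) \<otimes> s = (x \<otimes> z) \<otimes> t"
      using st c x by (simp add: m_assoc)
    show "cl (x \<otimes> y) = cl (x \<otimes> z)"
      using eq st c x by (subst cl_eq_iff) auto
    then show "cl (y \<otimes> x) = cl (z \<otimes> x)"
      using c x by (simp add: m_comm)
  qed
  from UN_equiv_class2[OF equiv_rel equiv_rel this assms] show ?thesis
    by (simp add: marshall_quotient_def)
qed

lemma neg_cl:
  assumes "a \<in> carrier R"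
  shows "mneg (marshall_quotient R S) (cl a) = cl (\<ominus> a)"
proof -
  have "congruent (marshall_rel R S) (\<lambda>a. cl (\<ominus> a))"
  proof (rule congruentI)
    fix y z assume yz: "(y, z) \<in> marshall_rel R S"
    then obtain s t where st: "s \<in> S" "t \<in> S" "y \<otimes> s = z \<otimes> t"
      and c: "y \<in> carrier R" "z \<in> carrier R"
      by (auto simp: marshall_rel_def)
    have eq: "(\<ominus> y) \<otimes> s = (\<ominus> z) \<otimes> t"
      using st c by (simp add: l_minus)
    show "cl (\<ominus> y) = cl (\<ominus> z)"
      using eq st c by (subst cl_eq_iff) auto
  qed
  from UN_equiv_class[OF equiv_rel this assms] show ?thesis
    by (simp add: marshall_quotient_def)
qed

lemma madd_cl:
  assumes a: "a \<in> carrier R" and b: "b \<in> carrier R"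
  shows "madd (marshall_quotient R S) (cl a) (cl b) =
    {cl c | c. c \<in> carrier R \<and>
       (\<exists>r\<in>S. \<exists>s\<in>S. \<exists>t\<in>S. c \<otimes> r = a \<otimes> s \<oplus> b \<otimes> t)}" (is "?L = ?R")
proof
  show "?R \<subseteq> ?L"
    unfolding marshall_quotient_def multiring.simps using assms by blast
  show "?L \<subseteq> ?R"
  proof
    fix Z assume "Z \<in> ?L"
    then obtain a' b' c r s t where Z: "Z = cl c"
      and carr: "a' \<in> carrier R" "b' \<in> carrier R" "c \<in> carrier R"
      and eq: "cl a = cl a'" "cl b = cl b'"
      and rst: "r \<in> S" "s \<in> S" "t \<in> S" "c \<otimes> r = a' \<otimes> s \<oplus> b' \<otimes> t"
      by (auto simp: marshall_quotient_def)
    obtain p q where pq: "p \<in> S" "q \<in> S" "a \<otimes> p = a' \<otimes> q"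
      using eq(1) cl_eq_iff[OF a carr(1)] by blast
    obtain p' q' where pq': "p' \<in> S" "q' \<in> S" "b \<otimes> p' = b' \<otimes> q'"
      using eq(2) cl_eq_iff[OF b carr(2)] by blast
    have S_in: "r \<otimes> (q \<otimes> q') \<in> S" "p \<otimes> (s \<otimes> q') \<in> S" "p' \<otimes> (t \<otimes> q) \<in> S"
      using rst pq pq' by (simp_all add: S_mult)
    have "c \<otimes> (r \<otimes> (q \<otimes> q')) = (c \<otimes> r) \<otimes> (q \<otimes> q')"
      using rst(1) pq(2) pq'(2) carr by (simp add: m_assoc)
    also have "\<dots> = (a' \<otimes> q) \<otimes> (s \<otimes> q') \<oplus> (b' \<otimes> q') \<otimes> (t \<otimes> q)"
      unfolding rst(4) using rst(2,3) pq(2) pq'(2) carr by (simp add: l_distr r_distr m_ac)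
    also have "\<dots> = (a \<otimes> p) \<otimes> (s \<otimes> q') \<oplus> (b \<otimes> p') \<otimes> (t \<otimes> q)"
      by (simp only: pq(3) pq'(3))
    also have "\<dots> = a \<otimes> (p \<otimes> (s \<otimes> q')) \<oplus> b \<otimes> (p' \<otimes> (t \<otimes> q))"
      using rst pq(1,2) pq'(1,2) a b by (simp add: m_assoc)
    finally show "Z \<in> ?R"
      using S_in carr(3) Z by blast
  qed
qed

end

lemma marshall_unit_squares:
  assumes "cring R"
  shows "marshall R (unit_squares R)"
proof -
  interpret cring R by fact
  show ?thesis
  proof
    show "unit_squares R \<subseteq> carrier R"
      by (auto simp: unit_squares_def)
    show "\<one>\<^bsub>R\<^esub> \<in> unit_squares R"
      unfolding unit_squares_def using Units_one_closed l_one[OF one_closed] by force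
    fix s t assume "s \<in> unit_squares R" "t \<in> unit_squares R"
    then obtain u v where uv: "u \<in> Units R" "v \<in> Units R"
      and "s = u \<otimes>\<^bsub>R\<^esub> u" "t = v \<otimes>\<^bsub>R\<^esub> v"
      by (auto simp: unit_squares_def)
    then have "s \<otimes>\<^bsub>R\<^esub> t = (u \<otimes>\<^bsub>R\<^esub> v) \<otimes>\<^bsub>R\<^esub> (u \<otimes>\<^bsub>R\<^esub> v)"
      by (simp add: m_ac Units_closed)
    then show "s \<otimes>\<^bsub>R\<^esub> t \<in> unit_squares R"
      unfolding unit_squares_def using uv by blast
  qed
qed

lemma marshall_M: "marshall (ZFact (int n)) (unit_squares (ZFact (int n)))"
  by (rule marshall_unit_squares) (rule ZFact_is_cring)

end

theory Submission
  imports Defs "HOL-Number_Theory.Cong"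
begin

text \<open>
  Since the squares of units form a group, \<open>[c] \<in> [1] + [-1]\<close> says exactly that \<open>c\<close> is a
  difference \<open>u\<^sup>2 - v\<^sup>2\<close> with units \<open>u, v\<close>, because any unit squares multiplied onto
  \<open>c\<close> can be divided out (\<open>hyperbolic_iff_diff_unit_squares\<close>). So the question is for which
  \<open>n\<close> every residue modulo \<open>n\<close> is such a difference.

  The only square of a unit modulo \<open>2\<close> or \<open>3\<close> is \<open>1\<close>, and modulo \<open>5\<close> there are \<open>1\<close> and \<open>-1\<close>.
  Their differences are \<open>0\<close>, respectively \<open>0, 2, -2\<close>, so \<open>1\<close> is missed. A representation of
  \<open>1\<close> modulo \<open>n\<close> would reduce to one modulo each divisor of \<open>n\<close>, so if \<open>M(n)\<close> is hyperbolic then none of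
  \<open>2, 3, 5\<close> divides \<open>n\<close> (\<open>one_not_diff_unit_squares\<close>).

  Conversely, let \<open>n\<close> be prime to \<open>30\<close>. For a unit \<open>d\<close>, the factorization
  \<open>c = (c/d) \<cdot> d = (u - v)(u + v)\<close> has the solution \<open>u = (d\<^sup>2 + c)/(2d)\<close>,
  \<open>v = (d\<^sup>2 - c)/(2d)\<close>, so it is enough that \<open>d\<close>, \<open>d\<^sup>2 - c\<close> and \<open>d\<^sup>2 + c\<close> are all prime
  to \<open>n\<close>, i.e. that \<open>d (d\<^sup>4 - c\<^sup>2)\<close> is. Modulo a single prime \<open>p \<ge> 7\<close> one of \<open>d = 1\<close> and \<open>d = 2\<close>
  works: otherwise \<open>p\<close> would divide \<open>2\<close> or both \<open>1 - c\<^sup>2\<close> and \<open>16 - c\<^sup>2\<close>, hence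
  their difference \<open>15\<close>. The Chinese remainder theorem glues these choices over the primes
  dividing \<open>n\<close> (\<open>exists_coprime_quintic\<close>).
\<close>

section \<open>Hyperbolicity and differences of unit squares\<close>

text \<open>
  If \<open>[c]\<close> lies in \<open>[1] + [-1]\<close>, then some representative \<open>c'\<close> of the class satisfies
  \<open>c' r = s - t\<close> with unit squares \<open>r, s, t\<close>, and \<open>c p = c' q\<close>. Hence
  \<open>c (p r) = q s - q t\<close>, where all factors are unit squares, and \<open>p r\<close> can be inverted.
\<close>

lemma hyperbolic_iff_diff_unit_squares:
  fixes R (structure)
  assumes "cring R"
  shows "hyperbolic (marshall_quotient R (unit_squares R)) \<longleftrightarrow>
    (\<forall>c\<in>carrier R. \<exists>u\<in>Units R. \<exists>v\<in>Units R. c = u \<otimes> u \<ominus> v \<otimes> v)"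
proof -
  interpret cring R by fact
  interpret marshall R "unit_squares R" by (rule marshall_unit_squares) fact
  let ?S = "unit_squares R"
  let ?A = "{cl c | c. c \<in> carrier R \<and>
       (\<exists>r\<in>?S. \<exists>s\<in>?S. \<exists>t\<in>?S. c \<otimes> r = \<one> \<otimes> s \<oplus> (\<ominus> \<one>) \<otimes> t)}"
  have "madd (marshall_quotient R ?S) (cl \<one>) (mneg (marshall_quotient R ?S) (cl \<one>)) = ?A"
    using neg_cl[OF one_closed] madd_cl[OF one_closed a_inv_closed[OF one_closed]] by simp
  then have hyp: "hyperbolic (marshall_quotient R ?S) \<longleftrightarrow> ?A = carrier R // marshall_rel R ?S"
    unfolding hyperbolic_def by (simp add: marshall_quotient_def)
  have minus: "\<one> \<otimes> s \<oplus> (\<ominus> \<one>) \<otimes> t = s \<ominus> t" if "s \<in> ?S" "t \<in> ?S" for s t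
    using that by (simp add: l_minus minus_eq)
  have quot: "carrier R // marshall_rel R ?S = {cl c | c. c \<in> carrier R}"
    by (auto simp: quotient_def)
  show ?thesis
  proof
    assume "hyperbolic (marshall_quotient R ?S)"
    from trans[OF iffD1[OF hyp this] quot] have A: "?A = {cl c | c. c \<in> carrier R}" .
    show "\<forall>c\<in>carrier R. \<exists>u\<in>Units R. \<exists>v\<in>Units R. c = u \<otimes> u \<ominus> v \<otimes> v"
    proof
      fix c assume c: "c \<in> carrier R"
      then have "cl c \<in> ?A" unfolding A by blast
      then obtain c' r s t where c': "c' \<in> carrier R" "cl c = cl c'"
        and rst: "r \<in> ?S" "s \<in> ?S" "t \<in> ?S" "c' \<otimes> r = s \<ominus> t"
        using minus by auto
      obtain p q where pq: "p \<in> ?S" "q \<in> ?S" "c \<otimes> p = c' \<otimes> q"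
        using c'(2) cl_eq_iff[OF c c'(1)] by blast
      have "p \<otimes> r \<in> ?S" "q \<otimes> s \<in> ?S" "q \<otimes> t \<in> ?S"
        using pq rst by (simp_all add: S_mult)
      then obtain w x y where wxy: "w \<in> Units R" "x \<in> Units R" "y \<in> Units R"
        and eqs: "p \<otimes> r = w \<otimes> w" "q \<otimes> s = x \<otimes> x" "q \<otimes> t = y \<otimes> y"
        by (auto simp: unit_squares_def)
      note [simp] = Units_closed Units_inv_closed
      have [simp]: "p \<in> carrier R" "q \<in> carrier R" "r \<in> carrier R" "s \<in> carrier R" "t \<in> carrier R"
        using pq(1,2) rst(1-3) by simp_all
      have "c \<otimes> (w \<otimes> w) = c \<otimes> (p \<otimes> r)" by (simp only: eqs)
      also have "\<dots> = (c \<otimes> p) \<otimes> r" using c by (simp add: m_assoc)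
      also have "\<dots> = q \<otimes> (c' \<otimes> r)"
        unfolding pq(3) using c'(1) by (simp add: m_ac)
      also have "\<dots> = q \<otimes> s \<ominus> q \<otimes> t"
        unfolding rst(4) by (simp add: minus_eq r_distr r_minus)
      finally have cw: "c \<otimes> (w \<otimes> w) = x \<otimes> x \<ominus> y \<otimes> y" by (simp only: eqs)
      \<comment> \<open>Dividing by \<open>w\<^sup>2\<close> turns \<open>x, y\<close> into the units \<open>x/w, y/w\<close>.\<close>
      have "c = c \<otimes> ((w \<otimes> inv w) \<otimes> (w \<otimes> inv w))" using c wxy by simp
      also have "\<dots> = (c \<otimes> (w \<otimes> w)) \<otimes> (inv w \<otimes> inv w)"
        using c wxy(1) by (simp add: m_ac del: Units_r_inv Units_l_inv)
      also have "\<dots> = (x \<otimes> inv w) \<otimes> (x \<otimes> inv w) \<ominus> (y \<otimes> inv w) \<otimes> (y \<otimes> inv w)"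
        unfolding cw using wxy by (simp add: minus_eq r_distr r_minus m_ac)
      finally show "\<exists>u\<in>Units R. \<exists>v\<in>Units R. c = u \<otimes> u \<ominus> v \<otimes> v"
        using wxy by blast
    qed
  next
    assume diff: "\<forall>c\<in>carrier R. \<exists>u\<in>Units R. \<exists>v\<in>Units R. c = u \<otimes> u \<ominus> v \<otimes> v"
    have "\<exists>r\<in>?S. \<exists>s\<in>?S. \<exists>t\<in>?S. c \<otimes> r = \<one> \<otimes> s \<oplus> (\<ominus> \<one>) \<otimes> t"
      if c: "c \<in> carrier R" for c
    proof -
      obtain u v where uv: "u \<in> Units R" "v \<in> Units R" "c = u \<otimes> u \<ominus> v \<otimes> v"
        using diff c by blast
      then have sq: "u \<otimes> u \<in> ?S" "v \<otimes> v \<in> ?S" by (auto simp: unit_squares_def)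
      have "c \<otimes> \<one> = \<one> \<otimes> (u \<otimes> u) \<oplus> (\<ominus> \<one>) \<otimes> (v \<otimes> v)"
        unfolding minus[OF sq] r_one[OF c] by (rule uv(3))
      with sq show ?thesis using S_one by blast
    qed
    then have "?A = {cl c | c. c \<in> carrier R}" by (intro Collect_cong) metis
    from iffD2[OF hyp trans[OF this quot[symmetric]]]
    show "hyperbolic (marshall_quotient R ?S)" .
  qed
qed

section \<open>Translation to congruences of integers\<close>

lemma carrier_ZFact: "carrier (ZFact k) = range (ZMod k)"
  unfolding ZFact_def FactRing_def A_RCOSETS_def' ZMod_def by auto

lemma ZMod_ring_hom: "ring_hom_cring \<Z> (ZFact k) (ZMod k)"
proof -
  interpret I: ideal "Idl\<^bsub>\<Z>\<^esub> {k}" \<Z> by (rule int.genideal_ideal) simp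
  have "ZMod k = (+>\<^bsub>\<Z>\<^esub>) (Idl\<^bsub>\<Z>\<^esub> {k})" by (simp add: ZMod_def fun_eq_iff)
  then show ?thesis
    using I.rcos_ring_hom_cring[OF int_is_cring] by (simp add: ZFact_def)
qed

lemma ZMod_eq_iff_cong: "ZMod k a = ZMod k b \<longleftrightarrow> [a = b] (mod k)"
  by (simp add: ZMod_eq_mod cong_def)

lemma ZMod_Units_iff: "ZMod k a \<in> Units (ZFact k) \<longleftrightarrow> coprime a k"
proof -
  interpret h: ring_hom_cring \<Z> "ZFact k" "ZMod k" by (rule ZMod_ring_hom)
  have mult: "ZMod k a \<otimes>\<^bsub>ZFact k\<^esub> ZMod k b = ZMod k (a * b)" for b
    using h.hom_mult[of a b] by simp
  have one: "ZMod k 1 = \<one>\<^bsub>ZFact k\<^esub>"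
    using h.hom_one by simp
  have "ZMod k b \<otimes>\<^bsub>ZFact k\<^esub> ZMod k a = ZMod k a \<otimes>\<^bsub>ZFact k\<^esub> ZMod k b" for b
    by (rule h.S.m_comm) (simp_all add: carrier_ZFact)
  then have "ZMod k a \<in> Units (ZFact k) \<longleftrightarrow>
      (\<exists>b. ZMod k a \<otimes>\<^bsub>ZFact k\<^esub> ZMod k b = \<one>\<^bsub>ZFact k\<^esub>)"
    unfolding Units_def carrier_ZFact by blast
  also have "\<dots> \<longleftrightarrow> (\<exists>b. [a * b = 1] (mod k))"
    unfolding mult one[symmetric] ZMod_eq_iff_cong ..
  finally show ?thesis unfolding coprime_iff_invertible_int .
qed

lemma hyperbolic_M_iff:
  "hyperbolic (M n) \<longleftrightarrow>
    (\<forall>c. \<exists>u v. coprime u (int n) \<and> coprime v (int n) \<and> [c = u^2 - v^2] (mod int n))"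
proof -
  let ?k = "int n" and ?R = "ZFact (int n)"
  interpret h: ring_hom_cring \<Z> ?R "ZMod ?k" by (rule ZMod_ring_hom)
  have diff: "ZMod ?k u \<otimes>\<^bsub>?R\<^esub> ZMod ?k u \<ominus>\<^bsub>?R\<^esub> ZMod ?k v \<otimes>\<^bsub>?R\<^esub> ZMod ?k v = ZMod ?k (u^2 - v^2)"
    for u v
  proof -
    have mult: "ZMod ?k (a * b) = ZMod ?k a \<otimes>\<^bsub>?R\<^esub> ZMod ?k b" for a b
      using h.hom_mult[of a b] by simp
    have add: "ZMod ?k (a + b) = ZMod ?k a \<oplus>\<^bsub>?R\<^esub> ZMod ?k b" for a b
      using h.hom_add[of a b] by simp
    have neg: "ZMod ?k (- a) = \<ominus>\<^bsub>?R\<^esub> ZMod ?k a" for a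
      using h.hom_a_inv[of a] by simp
    have "u^2 - v^2 = u * u + - (v * v)" by (simp add: power2_eq_square)
    then show ?thesis by (simp only: mult add neg h.S.minus_eq)
  qed
  have "Units ?R = ZMod ?k ` {a. coprime a ?k}"
  proof
    show "Units ?R \<subseteq> ZMod ?k ` {a. coprime a ?k}"
    proof
      fix x assume x: "x \<in> Units ?R"
      then obtain a where "x = ZMod ?k a" using h.S.Units_closed carrier_ZFact by blast
      with x show "x \<in> ZMod ?k ` {a. coprime a ?k}" by (simp add: ZMod_Units_iff)
    qed
  qed (auto simp: ZMod_Units_iff)
  then have units: "(\<exists>x\<in>Units ?R. P x) \<longleftrightarrow> (\<exists>a. coprime a ?k \<and> P (ZMod ?k a))" for P
    by auto
  have carrier: "(\<forall>x\<in>carrier ?R. P x) \<longleftrightarrow> (\<forall>a. P (ZMod ?k a))" for P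
    by (auto simp: carrier_ZFact)
  show ?thesis
    unfolding M_def hyperbolic_iff_diff_unit_squares[OF ZFact_is_cring]
    by (simp only: carrier units diff ZMod_eq_iff_cong ex_simps)
qed

section \<open>The primes 2, 3 and 5 are obstructions\<close>

text \<open>
  The congruence and the coprimality both descend to the divisor \<open>q\<close> of \<open>k\<close>, where only the
  squares \<open>1\<close> and, for \<open>q = 5\<close>, also \<open>4\<close> occur.
\<close>

lemma one_not_diff_unit_squares:
  fixes u v k q :: int
  assumes q: "q \<in> {2, 3, 5}" and "q dvd k"
    and "coprime u k" "coprime v k" and eq: "[1 = u^2 - v^2] (mod k)"
  shows False
proof -
  have sq: "w^2 mod q = 1 \<or> q = 5 \<and> w^2 mod q = 4" if "coprime w k" for w
  proof -
    have "coprime w q" using \<open>coprime w k\<close> \<open>q dvd k\<close> coprime_divisors dvd_refl by blast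
    moreover have "\<not> is_unit q" using q by auto
    ultimately have "w mod q \<noteq> 0" by (auto simp: coprime_absorb_right mod_eq_0_iff_dvd)
    moreover have "0 \<le> w mod q" "w mod q < q" using q by auto
    ultimately have "w mod q \<in> {1, 2, 3, 4}" "w mod q < q" using q by auto
    moreover have "w^2 mod q = (w mod q)^2 mod q" by (simp add: power_mod)
    ultimately show ?thesis using q by (elim insertE emptyE) simp_all
  qed
  have "[1 = u^2 - v^2] (mod q)" using eq \<open>q dvd k\<close> cong_dvd_modulus by blast
  then have "1 mod q = (u^2 mod q - v^2 mod q) mod q" by (simp add: cong_def mod_diff_eq)
  with sq[OF \<open>coprime u k\<close>] sq[OF \<open>coprime v k\<close>] q show False by (elim insertE emptyE disjE conjE) simp_all
qed

section \<open>Solvability for moduli prime to 30\<close>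

text \<open>
  The quintic is \<open>d (d\<^sup>2 + c) (d\<^sup>2 - c)\<close>. A value of \<open>d\<close> such as \<open>1\<close> or \<open>2\<close> may fail for some of the
  primes dividing \<open>n\<close>, but being prime to \<open>n\<close> depends only on \<open>d\<close> modulo each of these primes,
  so \<open>d\<close> may be chosen for each prime separately.
\<close>

lemma exists_coprime_quintic:
  fixes c :: int and n :: nat
  assumes n: "n \<ge> 1" "coprime n 30"
  shows "\<exists>d::int. coprime (d * (d^4 - c^2)) (int n)"
proof -
  define e :: "nat \<Rightarrow> nat" where "e p = (if int p dvd 1 - c^2 then 2 else 1)" for p
  have "\<forall>p\<in>prime_factors n. \<forall>q\<in>prime_factors n. p \<noteq> q \<longrightarrow> coprime p q"
    by (auto intro: primes_coprime)
  then obtain x where x: "\<And>p. p \<in> prime_factors n \<Longrightarrow> [x = e p] (mod p)"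
    using chinese_remainder_nat[of "prime_factors n" "\<lambda>p. p" e] by auto
  have "\<not> int p dvd int x * (int x^4 - c^2)" if p: "prime p" "p dvd n" for p
  proof
    assume dvd: "int p dvd int x * (int x^4 - c^2)"
    have "coprime p 30" using n(2) p(2) coprime_divisors dvd_refl by blast
    then have p30: "\<not> p dvd 30" using p(1) by (metis coprime_absorb_left not_prime_unit)
    have "[x = e p] (mod p)" using x p n(1) by (simp add: in_prime_factors_iff)
    then have "[int x = int (e p)] (mod int p)" by (simp add: cong_int_iff)
    then have "[int x * (int x^4 - c^2) = int (e p) * (int (e p)^4 - c^2)] (mod int p)"
      by (intro cong_mult cong_diff cong_pow cong_refl)
    with dvd have e: "int p dvd int (e p) * (int (e p)^4 - c^2)"
      using cong_dvd_iff by blast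
    show False
    proof (cases "int p dvd 1 - c^2")
      case True
      with e have "int p dvd 2 * (16 - c^2)" by (simp add: e_def)
      moreover have "int p dvd 2 * (1 - c^2)" using True by (rule dvd_mult)
      \<comment> \<open>The factor \<open>2\<close> is \<open>d\<close> itself; the two multiples of \<open>p\<close> differ by \<open>30\<close>.\<close>
      ultimately have "int p dvd 2 * (16 - c^2) - 2 * (1 - c^2)" by (rule dvd_diff)
      then have "int p dvd int 30" by simp
      with p30 show False using int_dvd_int_iff by blast
    next
      case False
      with e show False by (simp add: e_def)
    qed
  qed
  note no_prime = this
  have "coprime (int x * (int x^4 - c^2)) (int n)"
  proof (rule ccontr)
    assume "\<not> ?thesis"
    then have "\<bar>gcd (int x * (int x^4 - c^2)) (int n)\<bar> \<noteq> 1"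
      by (simp add: coprime_iff_gcd_eq_1)
    then obtain p :: int where p: "prime p" "p dvd gcd (int x * (int x^4 - c^2)) (int n)"
      using prime_factor_int by blast
    obtain m where m: "p = int m" using prime_ge_0_int[OF p(1)] nonneg_int_cases by blast
    have "prime m" "m dvd n" using p m by simp_all
    moreover have "int m dvd int x * (int x^4 - c^2)"
      using p(2) m by (metis dvd_trans gcd_dvd1)
    ultimately show False using no_prime by blast
  qed
  then show ?thesis by blast
qed

text \<open>
  With \<open>w\<close> an inverse of \<open>2 d\<close>, the representation comes from the identity
  \<open>(d\<^sup>2 + c)\<^sup>2 - (d\<^sup>2 - c)\<^sup>2 = (2 d)\<^sup>2 c\<close>.
\<close>

lemma diff_unit_squares_if_coprime_30:
  fixes c :: int and n :: nat
  assumes n: "n \<ge> 1" "coprime n 30"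
  shows "\<exists>u v. coprime u (int n) \<and> coprime v (int n) \<and> [c = u^2 - v^2] (mod int n)"
proof -
  obtain d :: int where "coprime (d * (d^4 - c^2)) (int n)"
    using exists_coprime_quintic[OF n] by blast
  moreover have "d * (d^4 - c^2) = d * ((d^2 + c) * (d^2 - c))"
    by (simp add: algebra_simps power2_eq_square power4_eq_xxxx)
  ultimately have d: "coprime d (int n)" "coprime (d^2 + c) (int n)" "coprime (d^2 - c) (int n)"
    by simp_all
  have "coprime n 2" using n(2) by (rule coprime_divisors[rotated 2]) simp_all
  then have "coprime (2 * d) (int n)"
    using d(1) by (simp add: coprime_commute)
  then obtain w where w: "[2 * d * w = 1] (mod int n)"
    using coprime_iff_invertible_int by blast
  then have w_unit: "coprime w (int n)"
    using coprime_iff_invertible_int by (metis mult.commute)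
  define u where "u = w * (d^2 + c)"
  define v where "v = w * (d^2 - c)"
  have "u^2 - v^2 = (2 * d * w)^2 * c"
    unfolding u_def v_def by (simp add: algebra_simps power2_eq_square)
  moreover have "[(2 * d * w)^2 * c = 1^2 * c] (mod int n)"
    using w by (intro cong_mult cong_pow cong_refl)
  ultimately have "[c = u^2 - v^2] (mod int n)" by (simp add: cong_sym_eq)
  moreover have "coprime u (int n)" "coprime v (int n)"
    using d w_unit by (simp_all add: u_def v_def)
  ultimately show ?thesis by blast
qed

section \<open>The classification\<close>

lemma coprime_30_iff: "coprime n 30 \<longleftrightarrow> \<not> 2 dvd n \<and> \<not> 3 dvd n \<and> \<not> 5 dvd n" for n :: nat
proof -
  have "coprime n p \<longleftrightarrow> \<not> p dvd n" if "prime p" for p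
    using that by (metis coprime_commute prime_imp_coprime coprime_absorb_left not_prime_unit)
  moreover have "prime (2::nat)" "prime (3::nat)" "prime (5::nat)"
    by simp_all
  moreover have "coprime n (2 * (3 * 5)) \<longleftrightarrow> coprime n 2 \<and> coprime n 3 \<and> coprime n 5"
    by (simp only: coprime_mult_right_iff)
  ultimately show ?thesis by simp
qed

theorem theorem5p7:
  fixes n :: nat
  assumes "n \<ge> 1"
  shows "(hyperbolic (M n) \<longleftrightarrow> gcd n 30 = 1) \<and>
         (hyperbolic (M n) \<longleftrightarrow> \<not> 2 dvd n \<and> \<not> 3 dvd n \<and> \<not> 5 dvd n)"
proof -
  have "hyperbolic (M n) \<longleftrightarrow> coprime n 30"
  proof
    assume "hyperbolic (M n)"
    then obtain u v where uv: "coprime u (int n)" "coprime v (int n)" "[1 = u^2 - v^2] (mod int n)"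
      unfolding hyperbolic_M_iff by blast
    have "\<not> q dvd n" if "int q \<in> {2, 3, 5}" for q
      using one_not_diff_unit_squares[OF that _ uv] by auto
    from this[of 2] this[of 3] this[of 5] show "coprime n 30"
      unfolding coprime_30_iff by simp
  next
    assume "coprime n 30"
    then show "hyperbolic (M n)"
      unfolding hyperbolic_M_iff using diff_unit_squares_if_coprime_30[OF assms] by blast
  qed
  then show ?thesis
    by (simp add: coprime_iff_gcd_eq_1 flip: coprime_30_iff)
qed

end
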